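(* Inside the $m\times n$ table, we have $$\mathcal{C}(s,t)=3^{s-1}-\sum_{i=t+1}^{s-1}3^{\,s-i-1}\,\mathcal{C}^1(i,t)-\sum_{i=m+2-t}^{s-1}3^{\,s-i-1}\,\mathcal{C}^1(i,m+1-t)$$ for all $s\leq n+2$.
   Context: The $m\times n$ table has $m$ rows and $n$ columns; the $(x,y)$-cell is the cell in column $x$ and row $y$. A lattice path inside the table is a sequence of cells of the table in which consecutive cells differ by a step in $\{(1,1),(1,0),(1,-1)\}$. For a row $i$, $\mathcal{C}^i(s,t)$ is the number of lattice paths inside the table from the $(1,i)$-cell to the $(s,t)$-cell; in particular $\mathcal{C}^1(s,t)$ is the number of such paths from the $(1,1)$-cell to the $(s,t)$-cell. $\mathcal{C}(s,t)=\sum_{i=1}^m\mathcal{C}^i(s,t)$ is the number of lattice paths inside the table from the first column (starting at any of its $m$ cells) to the $(s,t)$-cell.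
   Formalization: The sums start at i=t and i=m+1-t, not t+1 and m+2-t: as printed the claim fails for m=n=2, s=2, t=1 (C=2, right side 3). For s=n+1, n+2, whose cells lie outside the table, the counts are taken in the table extended to s columns. *)

theory Defs
  imports Main
begin

text \<open>A cell is a pair (column, row); the table with \<open>m\<close> rows and \<open>n\<close> columns has its columns
  and rows numbered from 1.\<close>

type_synonym cell = "nat \<times> nat"

definition table :: "nat \<Rightarrow> nat \<Rightarrow> cell set" where
  "table m n = {1..n} \<times> {1..m}"

text \<open>The difference is taken in the integers because the downward step decreases the row.\<close>

definition is_step :: "cell \<Rightarrow> cell \<Rightarrow> bool" where
  "is_step c d \<longleftrightarrow>
    (int (fst d) - int (fst c), int (snd d) - int (snd c)) \<in> {(1, 1), (1, 0), (1, -1)}"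

definition lattice_paths :: "nat \<Rightarrow> nat \<Rightarrow> cell \<Rightarrow> cell \<Rightarrow> cell list set" where
  "lattice_paths m n c d =
    {p. p \<noteq> [] \<and> hd p = c \<and> last p = d \<and> set p \<subseteq> table m n \<and> successively is_step p}"

definition num_paths_from :: "nat \<Rightarrow> nat \<Rightarrow> nat \<Rightarrow> nat \<Rightarrow> nat \<Rightarrow> nat" where
  "num_paths_from m n i s t = card (lattice_paths m n (1, i) (s, t))"

definition num_paths :: "nat \<Rightarrow> nat \<Rightarrow> nat \<Rightarrow> nat \<Rightarrow> nat" where
  "num_paths m n s t = (\<Sum>i = 1..m. num_paths_from m n i s t)"

end

theory Submission
  imports Defs
begin

text \<open>Read backwards from \<open>(s, t)\<close>, there are \<open>3 ^ (s - 1)\<close> unrestricted paths to the first column,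
  and the two sums count those that leave the table through row \<open>0\<close> or row \<open>m + 1\<close>, according
  to the place of the first exit. Formally, both sides satisfy the same three-term recurrence in
  the column: the boundary rows \<open>0\<close> and \<open>m + 1\<close> carry no paths, and the missing \<open>3 ^ (s - 1)\<close>
  at a boundary row is the term \<open>i = 1\<close> of the corresponding sum.\<close>

lemma is_step_Suc_iff:
  assumes "1 \<le> t"
  shows "is_step d (Suc s, t) \<longleftrightarrow> d \<in> {(s, t - 1), (s, t), (s, t + 1)}"
  using assms by (cases d) (auto simp: is_step_def)

lemma lattice_paths_off_table:
  assumes "d \<notin> table m n"
  shows "lattice_paths m n c d = {}"
  using assms last_in_set by (fastforce simp: lattice_paths_def)

text \<open>A predecessor of a cell in column 1 would lie in column 0, outside the table, so only
  the one-cell path can end there.\<close>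

lemma lattice_paths_first_column:
  assumes "(1, t) \<in> table m n"
  shows "lattice_paths m n (1, i) (1, t) = (if i = t then {[(1, t)]} else {})"
proof -
  have "p = [(1, t)]" if p: "p \<in> lattice_paths m n (1, i) (1, t)" for p
  proof (cases p rule: rev_cases)
    case Nil
    with p show ?thesis by (simp add: lattice_paths_def)
  next
    case (snoc q x)
    have "q = []"
    proof (rule ccontr)
      assume "q \<noteq> []"
      with p snoc have "last q \<in> table m n" "is_step (last q) (1, t)"
        by (auto simp: lattice_paths_def successively_append_iff)
      then show False by (cases "last q") (auto simp: table_def is_step_def)
    qed
    with p snoc show ?thesis by (auto simp: lattice_paths_def)
  qed
  moreover have "[(1, t)] \<in> lattice_paths m n (1, i) (1, t) \<longleftrightarrow> i = t"
    using assms by (auto simp: lattice_paths_def)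
  ultimately show ?thesis by auto
qed

lemma lattice_paths_Suc_column:
  assumes "1 \<le> s" and "(Suc s, t) \<in> table m n"
  shows "lattice_paths m n (1, i) (Suc s, t) =
    (\<Union>d \<in> {(s, t - 1), (s, t), (s, t + 1)}. (\<lambda>p. p @ [(Suc s, t)]) ` lattice_paths m n (1, i) d)"
    (is "?L = ?R")
proof (intro equalityI subsetI)
  have t: "1 \<le> t" using assms(2) by (simp add: table_def)
  fix p assume p: "p \<in> ?L"
  then obtain q where q: "p = q @ [(Suc s, t)]"
    by (cases p rule: rev_cases) (auto simp: lattice_paths_def)
  \<comment> \<open>The path starts in column 1 but ends in column \<open>Suc s\<close> with
    \<open>s \<ge> 1\<close>, so it has more than one cell.\<close>
  have "q \<noteq> []" using p q assms(1) by (auto simp: lattice_paths_def)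
  with p q have "q \<in> lattice_paths m n (1, i) (last q)" "is_step (last q) (Suc s, t)"
    by (auto simp: lattice_paths_def successively_append_iff)
  with q show "p \<in> ?R" unfolding is_step_Suc_iff[OF t] by blast
next
  have t: "1 \<le> t" using assms(2) by (simp add: table_def)
  fix p assume "p \<in> ?R"
  then obtain d q where "d \<in> {(s, t - 1), (s, t), (s, t + 1)}" "q \<in> lattice_paths m n (1, i) d"
    "p = q @ [(Suc s, t)]"
    by blast
  with assms(2) show "p \<in> ?L"
    unfolding is_step_Suc_iff[OF t, symmetric]
    by (auto simp: lattice_paths_def successively_append_iff)
qed

lemma finite_lattice_paths:
  assumes "1 \<le> s"
  shows "finite (lattice_paths m n (1, i) (s, t))"
  using assms
proof (induction s arbitrary: t rule: dec_induct)
  case base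
  show ?case
    by (cases "(1, t) \<in> table m n")
      (use lattice_paths_first_column[of t m n i] in \<open>auto simp: lattice_paths_off_table\<close>)
next
  case (step s)
  then show ?case
    by (cases "(Suc s, t) \<in> table m n")
      (auto simp: lattice_paths_off_table lattice_paths_Suc_column[simplified])
qed

lemma num_paths_from_off_table:
  assumes "t \<notin> {1..m}"
  shows "num_paths_from m n i s t = 0"
  using assms by (simp add: num_paths_from_def lattice_paths_off_table table_def)

lemma num_paths_from_first_column:
  assumes "1 \<le> n" and "t \<in> {1..m}"
  shows "num_paths_from m n i 1 t = (if i = t then 1 else 0)"
  using assms lattice_paths_first_column[of t m n i]
  by (simp add: num_paths_from_def table_def)

lemma num_paths_from_Suc_column:
  assumes "1 \<le> s" and "Suc s \<le> n" and "t \<in> {1..m}"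
  shows "num_paths_from m n i (Suc s) t =
    num_paths_from m n i s (t - 1) + num_paths_from m n i s t + num_paths_from m n i s (t + 1)"
proof -
  let ?D = "{(s, t - 1), (s, t), (s, t + 1)}"
  let ?ext = "\<lambda>p. p @ [(Suc s, t)]"
  have "card (lattice_paths m n (1, i) (Suc s, t)) =
      card (\<Union>d \<in> ?D. ?ext ` lattice_paths m n (1, i) d)"
    using assms by (subst lattice_paths_Suc_column) (auto simp: table_def)
  \<comment> \<open>The pieces are disjoint because the next-to-last cell of a path determines
    \<open>d\<close>; finiteness is what makes the cardinalities add.\<close>
  also have "\<dots> = (\<Sum>d \<in> ?D. card (?ext ` lattice_paths m n (1, i) d))"
    using finite_lattice_paths[OF assms(1)]
    by (intro card_UN_disjoint) (auto simp: lattice_paths_def)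
  also have "\<dots> = (\<Sum>d \<in> ?D. card (lattice_paths m n (1, i) d))"
    by (intro sum.cong refl card_image) (auto simp: inj_on_def)
  \<comment> \<open>As \<open>t \<ge> 1\<close>, truncated subtraction does not identify
    \<open>t - 1\<close> with \<open>t\<close>, so \<open>?D\<close> really has three
    elements.\<close>
  also have "\<dots> = num_paths_from m n i s (t - 1) + num_paths_from m n i s t
      + num_paths_from m n i s (t + 1)"
    using assms(3) by (cases t) (auto simp: num_paths_from_def)
  finally show ?thesis by (simp add: num_paths_from_def)
qed

text \<open>Each step climbs at most one row, so a path from row 1 cannot be in row \<open>t\<close>
  before column \<open>t\<close>. This accounts for the lower limits of the sums in the final
  formula.\<close>

lemma num_paths_from_bottom_eq_0:
  assumes "1 \<le> s" and "s \<le> n" and "s < t"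
  shows "num_paths_from m n 1 s t = 0"
  using assms
proof (induction s arbitrary: t rule: dec_induct)
  case base
  then show ?case
    by (cases "t \<in> {1..m}")
      (simp_all add: num_paths_from_off_table num_paths_from_first_column[simplified])
next
  case (step s)
  then show ?case
    by (cases "t \<in> {1..m}") (simp_all add: num_paths_from_off_table num_paths_from_Suc_column)
qed

lemma num_paths_off_table:
  assumes "t \<notin> {1..m}"
  shows "num_paths m n s t = 0"
  using assms by (simp add: num_paths_def num_paths_from_off_table)

lemma num_paths_first_column:
  assumes "1 \<le> n" and "t \<in> {1..m}"
  shows "num_paths m n 1 t = 1"
  using assms by (simp add: num_paths_def num_paths_from_first_column[simplified])

lemma num_paths_Suc_column:
  assumes "1 \<le> s" and "Suc s \<le> n" and "t \<in> {1..m}"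
  shows "num_paths m n (Suc s) t =
    num_paths m n s (t - 1) + num_paths m n s t + num_paths m n s (t + 1)"
  using assms by (simp add: num_paths_def num_paths_from_Suc_column sum.distrib)

text \<open>Including the rows \<open>0\<close> and \<open>m + 1\<close>, where both sides vanish, spares the induction all
  case distinctions at the boundary.\<close>

lemma num_paths_eq_extended:
  assumes "1 \<le> m" and "Suc k \<le> n" and "t \<le> m + 1"
  shows "int (num_paths m n (Suc k) t) = (if t \<in> {1..m} then 3 ^ k else 0)
    - (\<Sum>j<k. 3 ^ (k - Suc j) * (int (num_paths_from m n 1 (Suc j) t)
        + int (num_paths_from m n 1 (Suc j) (m + 1 - t))))"
  using assms(2,3)
proof (induction k arbitrary: t)
  case 0
  then show ?case
    by (cases "t \<in> {1..m}")
      (auto simp: num_paths_off_table num_paths_first_column[simplified])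
next
  case (Suc k)
  \<comment> \<open>\<open>A\<close> merges the two boundary terms into one quantity symmetric under
    the reflection of rows; \<open>H\<close> is the total correction and \<open>P\<close> the
    unrestricted count, cut to 0 at the boundary rows.\<close>
  define A where "A j r = int (num_paths_from m n 1 (Suc j) r)
    + int (num_paths_from m n 1 (Suc j) (m + 1 - r))" for j r
  define H where "H l r = (\<Sum>j<l. 3 ^ (l - Suc j) * A j r)" for l r
  define P :: "nat \<Rightarrow> int" where "P r = (if r \<in> {1..m} then 3 ^ k else 0)" for r
  show ?case
  proof (cases "t \<in> {1..m}")
    case False
    with Suc.prems have "t = 0 \<or> t = m + 1" by auto
    then show ?thesis by (auto simp: num_paths_off_table num_paths_from_off_table)
  next
    case True
    then have t: "1 \<le> t" "t \<le> m" by auto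
    have IH: "int (num_paths m n (Suc k) r) = P r - H k r" if "r \<le> m + 1" for r
      using Suc.IH[of r] Suc.prems that by (simp add: P_def H_def A_def)
    \<comment> \<open>\<open>A 0 t\<close> is the number of boundary rows adjacent to row
      \<open>t\<close>; it is 2 when \<open>m = 1\<close>.\<close>
    have A0: "A 0 t = (if t = 1 then 1 else 0) + (if t = m then 1 else 0)"
    proof -
      have "m + 1 - t \<in> {1..m}" "1 = m + 1 - t \<longleftrightarrow> t = m" using t by auto
      then show ?thesis
        using True Suc.prems num_paths_from_first_column[of n t m 1]
          num_paths_from_first_column[of n "m + 1 - t" m 1]
        by (simp add: A_def)
    qed
    have A_Suc: "A (Suc j) t = A j (t - 1) + A j t + A j (t + 1)" if "j < k" for j
    proof -
      \<comment> \<open>Reflection exchanges the neighbours \<open>t - 1\<close> and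
        \<open>t + 1\<close>, so the reflected counts obey the same recurrence.\<close>
      have "m + 1 - t \<in> {1..m}" "m + 1 - t - 1 = m + 1 - (t + 1)"
        "m + 1 - t + 1 = m + 1 - (t - 1)"
        using t by auto
      then show ?thesis
        using that True Suc.prems by (simp add: A_def num_paths_from_Suc_column)
    qed
    \<comment> \<open>The term \<open>j = 0\<close> is split off; shifting the index in the rest
      restores the weights of \<open>H k\<close>.\<close>
    have "H (Suc k) t = 3 ^ k * A 0 t + (\<Sum>j<k. 3 ^ (k - Suc j) * A (Suc j) t)"
      by (simp add: H_def sum.lessThan_Suc_shift del: sum.lessThan_Suc)
    also have "(\<Sum>j<k. 3 ^ (k - Suc j) * A (Suc j) t) = H k (t - 1) + H k t + H k (t + 1)"
      by (simp add: H_def A_Suc distrib_left sum.distrib)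
    finally have H_Suc: "H (Suc k) t = 3 ^ k * A 0 t + (H k (t - 1) + H k t + H k (t + 1))" .
    \<comment> \<open>Each neighbour in a boundary row contributes 0 instead of
      \<open>3 ^ k\<close>, and \<open>A 0 t\<close> counts these neighbours.\<close>
    have P_sum: "P (t - 1) + P t + P (t + 1) = 3 ^ Suc k - 3 ^ k * A 0 t"
      using t by (auto simp: P_def A0)
    have "int (num_paths m n (Suc (Suc k)) t) =
        (P (t - 1) - H k (t - 1)) + (P t - H k t) + (P (t + 1) - H k (t + 1))"
      using Suc.prems True t by (simp add: num_paths_Suc_column IH)
    also have "\<dots> = 3 ^ Suc k - H (Suc k) t"
      using P_sum H_Suc by simp
    finally show ?thesis using True by (simp add: H_def A_def)
  qed
qed

theorem lemma2p9:
  fixes m n s t :: nat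
  assumes "1 \<le> m" and "1 \<le> n"
    and "1 \<le> t" and "t \<le> m"
    and "1 \<le> s" and "s \<le> n + 2"
  shows "int (num_paths m (max n s) s t) =
    3 ^ (s - 1)
    - (\<Sum>i = t..s - 1. 3 ^ (s - i - 1) * int (num_paths_from m (max n s) 1 i t))
    - (\<Sum>i = m + 1 - t..s - 1. 3 ^ (s - i - 1) * int (num_paths_from m (max n s) 1 i (m + 1 - t)))"
proof -
  \<comment> \<open>The width is \<open>n\<close> for \<open>s \<le> n\<close>; beyond that the
    table is widened to \<open>s\<close> columns so that column \<open>s\<close> exists.\<close>
  define N where "N = max n s"
  obtain k where k: "s = Suc k" using assms(5) by (cases s) auto
  have kN: "Suc k \<le> N" by (simp add: N_def k)
  \<comment> \<open>The terms with \<open>i < r\<close> vanish, so the sum may start at column 1;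
    then \<open>i = Suc j\<close>.\<close>
  have tail: "(\<Sum>i = r..k. 3 ^ (s - i - 1) * int (num_paths_from m N 1 i r)) =
      (\<Sum>j<k. 3 ^ (k - Suc j) * int (num_paths_from m N 1 (Suc j) r))" if "1 \<le> r" for r
  proof -
    have "(\<Sum>i = r..k. 3 ^ (s - i - 1) * int (num_paths_from m N 1 i r)) =
        (\<Sum>i = Suc 0..k. 3 ^ (s - i - 1) * int (num_paths_from m N 1 i r))"
      using that kN
      by (intro sum.mono_neutral_left) (auto simp: num_paths_from_bottom_eq_0[simplified])
    also have "\<dots> = (\<Sum>j<k. 3 ^ (k - Suc j) * int (num_paths_from m N 1 (Suc j) r))"
      unfolding sum.atLeast1_atMost_eq by (simp add: k)
    finally show ?thesis .
  qed
  have "int (num_paths m N s t) = 3 ^ k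
      - (\<Sum>j<k. 3 ^ (k - Suc j) * int (num_paths_from m N 1 (Suc j) t))
      - (\<Sum>j<k. 3 ^ (k - Suc j) * int (num_paths_from m N 1 (Suc j) (m + 1 - t)))"
    using num_paths_eq_extended[OF assms(1) kN, of t] assms(3,4)
    by (simp add: k distrib_left sum.distrib)
  then show ?thesis
    using tail[of t] tail[of "m + 1 - t"] assms(3,4) unfolding N_def[symmetric] by (simp add: k)
qed

end
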